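(* For every $n\geq 0$ and every $P\in\mathcal{D}_n^{h,\geq}$, $$\#UUU(P)=\#UF^+D(\phi(P))+2\big(\#UF^+U(\phi(P))+\#UU(\phi(P))\big).$$
   Context: A Motzkin path of length $n$ is a word in the steps $U=(1,1)$, $D=(1,-1)$, $F=(1,0)$ forming a lattice path from $(0,0)$ to $(n,0)$ never going below the $x$-axis; $\mathcal{M}_n$ is the set of them. A Dyck path of semilength $n$ is a Motzkin path of length $2n$ without $F$ steps. Every nonempty Dyck path has a unique first return decomposition $P=U\alpha D\beta$ with $\alpha,\beta$ Dyck paths; $h$ denotes maximal height. $\mathcal{D}^{h,\geq}$ is defined recursively: it contains the empty path $\epsilon$, and $P=U\alpha D\beta$ belongs to it iff $\alpha,\beta\in\mathcal{D}^{h,\geq}$ and $h(U\alpha D)\geq h(\beta)$; $\mathcal{D}_n^{h,\geq}$ is the subset of semilength $n$. The bijection $\phi:\mathcal{D}_n^{h,\geq}\to\mathcal{M}_n$ is defined by $\phi(\epsilon)=\epsilon$, $\phi(\alpha UD)=\phi(\alpha)F$, $\phi(\alpha UU\beta D\gamma D)=\phi(\alpha)\phi(\gamma)U\phi(\beta)D$. For a word $X$, $\#X(P)$ is the number of occurrences of $X$ as consecutive steps in $P$. For words $Y,Z$ and a step $S$, $\#YS^+Z(P)=\sum_{k\geq 1}\#YS^kZ(P)$, where $S^k$ is $k$ consecutive copies of $S$. *)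

theory Defs
  imports Complex_Main
begin

datatype step = U | D | F

fun rise :: "step \<Rightarrow> int" where
  "rise U = 1"
| "rise D = -1"
| "rise F = 0"

definition level :: "step list \<Rightarrow> int" where
  "level P = (\<Sum>s\<leftarrow>P. rise s)"

definition motzkin :: "step list \<Rightarrow> bool" where
  "motzkin P \<longleftrightarrow> level P = 0 \<and> (\<forall>i \<le> length P. 0 \<le> level (take i P))"

definition motzkin_paths :: "nat \<Rightarrow> step list set" where
  "motzkin_paths n = {P. motzkin P \<and> length P = n}"

definition dyck :: "step list \<Rightarrow> bool" where
  "dyck P \<longleftrightarrow> motzkin P \<and> F \<notin> set P"

definition height :: "step list \<Rightarrow> int" where
  "height P = Max ((\<lambda>i. level (take i P)) ` {..length P})"

text \<open>
  The class of Dyck paths defined recursively by first return decompositions. By uniqueness of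
  the decomposition the introduction rule is an equivalence, see \<open>dyck_h_ge_iff\<close> below.
\<close>

inductive_set dyck_h_ge :: "step list set" where
  empty: "[] \<in> dyck_h_ge"
| first_return: "\<alpha> \<in> dyck_h_ge \<Longrightarrow> \<beta> \<in> dyck_h_ge \<Longrightarrow> height ([U] @ \<alpha> @ [D]) \<ge> height \<beta>
    \<Longrightarrow> [U] @ \<alpha> @ [D] @ \<beta> \<in> dyck_h_ge"

definition dyck_h_ge_paths :: "nat \<Rightarrow> step list set" where
  "dyck_h_ge_paths n = {P \<in> dyck_h_ge. length P = 2 * n}"

text \<open>
  The map \<open>\<phi>\<close> is given by its recursive equations, as a relation first. The equations make sense
  for all Dyck paths; for a path in \<^const>\<open>dyck_h_ge\<close> the pieces \<open>\<alpha>\<close>, \<open>\<beta>\<close>, \<open>\<gamma>\<close> are again in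
  \<^const>\<open>dyck_h_ge\<close>. That the relation is a total function on Dyck paths, and hence that \<open>phi\<close>
  satisfies the equations, is proved below.
\<close>

inductive phi_rel :: "step list \<Rightarrow> step list \<Rightarrow> bool" where
  empty: "phi_rel [] []"
| flat: "dyck \<alpha> \<Longrightarrow> phi_rel \<alpha> a \<Longrightarrow> phi_rel (\<alpha> @ [U, D]) (a @ [F])"
| up: "dyck \<alpha> \<Longrightarrow> dyck \<beta> \<Longrightarrow> dyck \<gamma> \<Longrightarrow> phi_rel \<alpha> a \<Longrightarrow> phi_rel \<beta> b \<Longrightarrow> phi_rel \<gamma> c
    \<Longrightarrow> phi_rel (\<alpha> @ [U, U] @ \<beta> @ [D] @ \<gamma> @ [D]) (a @ c @ [U] @ b @ [D])"

definition phi :: "step list \<Rightarrow> step list" where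
  "phi P = (THE M. phi_rel P M)"

definition occ :: "step list \<Rightarrow> step list \<Rightarrow> nat" where
  "occ X P = card {i. i + length X \<le> length P \<and> take (length X) (drop i P) = X}"

text \<open>
  \<open>occ_plus Y S Z P\<close> counts the words \<open>Y S\<^sup>k Z\<close>, \<open>k \<ge> 1\<close>, in \<open>P\<close>. Only finitely many
  terms are nonzero, see \<open>occ_plus_finite\<close>.
\<close>

definition occ_plus :: "step list \<Rightarrow> step \<Rightarrow> step list \<Rightarrow> step list \<Rightarrow> nat" where
  "occ_plus Y S Z P = (\<Sum>k. occ (Y @ replicate (Suc k) S @ Z) P)"


lemma occ_eq_0: "length P < length X \<Longrightarrow> occ X P = 0"
  by (simp add: occ_def)

lemma occ_plus_finite:
  assumes "length P \<le> N"
  shows "occ_plus Y S Z P = (\<Sum>k = 1..N. occ (Y @ replicate k S @ Z) P)"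
proof -
  have "occ_plus Y S Z P = (\<Sum>k<N. occ (Y @ replicate (Suc k) S @ Z) P)"
    unfolding occ_plus_def
    by (rule suminf_finite) (use assms in \<open>auto intro!: occ_eq_0\<close>)
  then show ?thesis
    by (simp only: One_nat_def sum.atLeast1_atMost_eq)
qed

lemma level_simps [simp]:
  "level [] = 0" "level (s # P) = rise s + level P" "level (P @ Q) = level P + level Q"
  by (simp_all add: level_def)

lemma motzkin_iff: "motzkin P \<longleftrightarrow> level P = 0 \<and> (\<forall>A B. P = A @ B \<longrightarrow> 0 \<le> level A)"
  unfolding motzkin_def
  by (metis append_take_drop_id append_eq_conv_conj length_append le_add1)

lemma dyck_level: "dyck P \<Longrightarrow> level P = 0"
  by (simp add: dyck_def motzkin_def)

lemma dyck_prefix: "dyck (A @ B) \<Longrightarrow> 0 \<le> level A"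
  by (auto simp: dyck_def motzkin_iff)

lemma motzkin_Nil [simp]: "motzkin []"
  by (simp add: motzkin_def)

lemma dyck_Nil [simp]: "dyck []"
  by (simp add: dyck_def)

lemma motzkin_append: "motzkin P \<Longrightarrow> motzkin Q \<Longrightarrow> motzkin (P @ Q)"
  unfolding motzkin_iff by (auto simp: append_eq_append_conv2)

lemma motzkin_U_D: "motzkin P \<Longrightarrow> motzkin (U # P @ [D])"
  unfolding motzkin_iff by (auto simp: Cons_eq_append_conv append_eq_append_conv2)

lemma motzkin_F: "motzkin [F]"
  unfolding motzkin_iff by (auto simp: Cons_eq_append_conv)

lemma dyck_append: "dyck P \<Longrightarrow> dyck Q \<Longrightarrow> dyck (P @ Q)"
  by (auto simp: dyck_def motzkin_append)

lemma dyck_U_D: "dyck P \<Longrightarrow> dyck (U # P @ [D])"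
  by (auto simp: dyck_def motzkin_U_D)

lemma dyck_split: "dyck (A @ B) \<Longrightarrow> level A = 0 \<Longrightarrow> dyck A \<and> dyck B"
proof -
  assume *: "dyck (A @ B)" "level A = 0"
  have "0 \<le> level X" if "A = X @ Y" for X Y
    using * that dyck_prefix[of X "Y @ B"] by simp
  moreover have "0 \<le> level X" if "B = X @ Y" for X Y
    using * that dyck_prefix[of "A @ X" Y] by simp
  ultimately show ?thesis
    using * dyck_level[of "A @ B"] by (simp add: dyck_def motzkin_iff)
qed

lemma first_return_unique:
  assumes "dyck \<alpha>" "dyck \<alpha>'" "\<alpha> @ D # \<beta> = \<alpha>' @ D # \<beta>'"
  shows "\<alpha> = \<alpha>' \<and> \<beta> = \<beta>'"
proof -
  have *: False if "dyck \<alpha>" "dyck (\<alpha> @ D # \<zeta>)" for \<alpha> \<zeta>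
    using that dyck_level[of \<alpha>] dyck_prefix[of "\<alpha> @ [D]" \<zeta>] by simp
  from assms show ?thesis
    by (auto simp: append_eq_append_conv2 append_eq_Cons_conv Cons_eq_append_conv dest: *)
qed

lemma last_return_unique:
  assumes "dyck \<alpha>" "dyck \<alpha>'" "dyck \<delta>" "dyck \<delta>'" "\<alpha> @ U # \<delta> = \<alpha>' @ U # \<delta>'"
  shows "\<alpha> = \<alpha>' \<and> \<delta> = \<delta>'"
proof -
  have *: False if "dyck \<alpha>" "dyck (\<alpha> @ U # \<zeta>)" "dyck (\<zeta> @ U # \<delta>)" for \<alpha> \<zeta> \<delta>
    using that dyck_level[of \<alpha>] dyck_level[of "\<alpha> @ U # \<zeta>"] dyck_prefix[of \<zeta> "U # \<delta>"] by simp
  from assms show ?thesis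
    by (auto simp: append_eq_append_conv2 append_eq_Cons_conv Cons_eq_append_conv dest: *)
qed

lemma dyck_U_Cons:
  assumes "dyck P" "P \<noteq> []"
  obtains Q where "P = U # Q"
proof (cases P)
  case (Cons s Q)
  then have "0 \<le> level [s]" "s \<noteq> F"
    using assms dyck_prefix[of "[s]" Q] by (auto simp: dyck_def)
  then show ?thesis using Cons that by (cases s) auto
qed (use assms in simp)

lemma dyck_D_snoc:
  assumes "dyck P" "P \<noteq> []"
  obtains Q where "P = Q @ [D]"
proof (cases P rule: rev_cases)
  case (snoc Q s)
  then have "level Q + rise s = 0" "0 \<le> level Q" "s \<noteq> F"
    using assms dyck_prefix[of Q "[s]"] dyck_level[of P] by (auto simp: dyck_def)
  then show ?thesis using snoc that by (cases s) auto
qed (use assms in simp)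

lemma first_return_exists:
  assumes "dyck P" "P \<noteq> []"
  obtains \<alpha> \<beta> where "P = U # \<alpha> @ D # \<beta>" "dyck \<alpha>" "dyck \<beta>"
proof -
  obtain Q where Q: "P = U # Q" using assms dyck_U_Cons by blast
  define ok where "ok i \<longleftrightarrow> i \<le> length Q \<and> level (take i Q) < 0" for i
  have "level Q = -1" using assms Q dyck_level[of P] by simp
  then have "ok (length Q)" by (simp add: ok_def)
  define i where "i = (LEAST i. ok i)"
  have i: "ok i" "\<And>j. j < i \<Longrightarrow> \<not> ok j"
    using \<open>ok (length Q)\<close> unfolding i_def by (auto intro: LeastI dest: not_less_Least)
  obtain j where j: "i = Suc j" using i by (cases i) (auto simp: ok_def)
  define \<alpha> where "\<alpha> = take j Q"
  define \<beta> where "\<beta> = drop i Q"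
  have jl: "j < length Q" using i j by (simp add: ok_def)
  have spl: "Q = \<alpha> @ Q ! j # \<beta>"
    using jl j id_take_nth_drop[of j Q] by (simp add: \<alpha>_def \<beta>_def)
  have neg: "level \<alpha> + rise (Q ! j) < 0"
    using i(1) j jl by (simp add: ok_def \<alpha>_def take_Suc_conv_app_nth)
  have pre: "0 \<le> level (take k Q)" if "k \<le> j" for k
    using i(2)[of k] that j jl by (auto simp: ok_def)
  have "0 \<le> level \<alpha>" using pre[of j] by (simp add: \<alpha>_def)
  with neg have D: "Q ! j = D" and l0: "level \<alpha> = 0" by (cases "Q ! j"; simp)+
  have P: "P = (U # \<alpha> @ [D]) @ \<beta>" using Q spl D by simp
  have F: "F \<notin> set \<alpha>" using assms P by (auto simp: dyck_def)
  have "dyck \<alpha>"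
    unfolding dyck_def motzkin_def using F l0 pre jl by (auto simp: \<alpha>_def min_def)
  moreover have "dyck \<beta>"
    using dyck_split[of "U # \<alpha> @ [D]" \<beta>] assms P l0 by simp
  ultimately show ?thesis using that P by simp
qed

lemma last_return_exists:
  "dyck P \<Longrightarrow> P \<noteq> [] \<Longrightarrow> \<exists>\<alpha> \<delta>. P = \<alpha> @ U # \<delta> @ [D] \<and> dyck \<alpha> \<and> dyck \<delta>"
proof (induction "length P" arbitrary: P rule: less_induct)
  case less
  obtain \<alpha> \<beta> where *: "P = U # \<alpha> @ D # \<beta>" "dyck \<alpha>" "dyck \<beta>"
    using first_return_exists less.prems by blast
  show ?case
  proof (cases "\<beta> = []")
    case True
    then have "P = [] @ U # \<alpha> @ [D]" using * by simp
    then show ?thesis using * dyck_Nil by blast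
  next
    case False
    then obtain \<alpha>' \<delta> where **: "\<beta> = \<alpha>' @ U # \<delta> @ [D]" "dyck \<alpha>'" "dyck \<delta>"
      using less.hyps[of \<beta>] * by auto
    have "dyck ((U # \<alpha> @ [D]) @ \<alpha>')" using * ** dyck_append dyck_U_D by blast
    moreover have "P = ((U # \<alpha> @ [D]) @ \<alpha>') @ U # \<delta> @ [D]" using * ** by simp
    ultimately show ?thesis using ** by blast
  qed
qed

lemma dyck_h_ge_dyck: "P \<in> dyck_h_ge \<Longrightarrow> dyck P"
proof (induction rule: dyck_h_ge.induct)
  case (first_return \<alpha> \<beta>)
  then show ?case using dyck_append[OF dyck_U_D] by fastforce
qed simp

lemma dyck_h_ge_iff:
  assumes "dyck \<alpha>" "dyck \<beta>"
  shows "U # \<alpha> @ D # \<beta> \<in> dyck_h_ge \<longleftrightarrow>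
    \<alpha> \<in> dyck_h_ge \<and> \<beta> \<in> dyck_h_ge \<and> height (U # \<alpha> @ [D]) \<ge> height \<beta>"
proof
  assume "U # \<alpha> @ D # \<beta> \<in> dyck_h_ge"
  then show "\<alpha> \<in> dyck_h_ge \<and> \<beta> \<in> dyck_h_ge \<and> height (U # \<alpha> @ [D]) \<ge> height \<beta>"
  proof cases
    case (first_return \<alpha>' \<beta>')
    then have "\<alpha> = \<alpha>' \<and> \<beta> = \<beta>'"
      using first_return_unique[of \<alpha> \<alpha>' \<beta> \<beta>'] assms dyck_h_ge_dyck by simp
    then show ?thesis using first_return by simp
  qed
next
  assume "\<alpha> \<in> dyck_h_ge \<and> \<beta> \<in> dyck_h_ge \<and> height (U # \<alpha> @ [D]) \<ge> height \<beta>"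
  then show "U # \<alpha> @ D # \<beta> \<in> dyck_h_ge"
    using dyck_h_ge.first_return[of \<alpha> \<beta>] by simp
qed

lemma height_prefix: "height A \<le> height (A @ B)"
  unfolding height_def
proof (rule Max_mono)
  show "(\<lambda>i. level (take i A)) ` {..length A}
      \<subseteq> (\<lambda>i. level (take i (A @ B))) ` {..length (A @ B)}"
  proof clarify
    fix i assume "i \<le> length A"
    then have "level (take i A) = level (take i (A @ B))" "i \<in> {..length (A @ B)}" by auto
    then show "level (take i A) \<in> (\<lambda>i. level (take i (A @ B))) ` {..length (A @ B)}"
      by (rule image_eqI)
  qed
qed auto

lemma dyck_h_ge_last_return:
  "dyck \<alpha> \<Longrightarrow> dyck \<delta> \<Longrightarrow> \<alpha> @ U # \<delta> @ [D] \<in> dyck_h_ge \<Longrightarrow> \<alpha> \<in> dyck_h_ge \<and> \<delta> \<in> dyck_h_ge"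
proof (induction "length \<alpha>" arbitrary: \<alpha> rule: less_induct)
  case less
  show ?case
  proof (cases "\<alpha> = []")
    case True
    then show ?thesis
      using less.prems dyck_h_ge_iff[of \<delta> "[]"] dyck_h_ge.empty by simp
  next
    case False
    then obtain \<alpha>1 \<alpha>2 where *: "\<alpha> = U # \<alpha>1 @ D # \<alpha>2" "dyck \<alpha>1" "dyck \<alpha>2"
      using first_return_exists less.prems by blast
    let ?\<beta> = "\<alpha>2 @ U # \<delta> @ [D]"
    have "dyck ?\<beta>" using * less.prems dyck_append dyck_U_D by blast
    then have **: "\<alpha>1 \<in> dyck_h_ge" "?\<beta> \<in> dyck_h_ge" "height (U # \<alpha>1 @ [D]) \<ge> height ?\<beta>"
      using dyck_h_ge_iff[of \<alpha>1 ?\<beta>] * less.prems by simp_all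
    then have "\<alpha>2 \<in> dyck_h_ge \<and> \<delta> \<in> dyck_h_ge"
      using less.hyps[of \<alpha>2] * less.prems by simp
    moreover have "height (U # \<alpha>1 @ [D]) \<ge> height \<alpha>2"
      using ** height_prefix order_trans by blast
    ultimately show ?thesis using * ** dyck_h_ge_iff[of \<alpha>1 \<alpha>2] by simp
  qed
qed

lemma phi_rel_total: "dyck P \<Longrightarrow> \<exists>M. phi_rel P M"
proof (induction "length P" arbitrary: P rule: less_induct)
  case less
  show ?case
  proof (cases "P = []")
    case True
    then show ?thesis using phi_rel.empty by blast
  next
    case False
    then obtain \<alpha> \<delta> where *: "P = \<alpha> @ U # \<delta> @ [D]" "dyck \<alpha>" "dyck \<delta>"
      using last_return_exists less.prems by blast
    obtain a where a: "phi_rel \<alpha> a" using less.hyps[of \<alpha>] * by auto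
    show ?thesis
    proof (cases "\<delta> = []")
      case True
      then show ?thesis using phi_rel.flat[OF *(2) a] * by auto
    next
      case False
      then obtain \<beta> \<gamma> where **: "\<delta> = U # \<beta> @ D # \<gamma>" "dyck \<beta>" "dyck \<gamma>"
        using first_return_exists * by blast
      obtain b c where "phi_rel \<beta> b" "phi_rel \<gamma> c"
        using less.hyps[of \<beta>] less.hyps[of \<gamma>] * ** by auto
      then show ?thesis using phi_rel.up[OF *(2) **(2,3) a] * ** by auto
    qed
  qed
qed

lemma phi_rel_unique: "phi_rel P M \<Longrightarrow> phi_rel P M' \<Longrightarrow> M = M'"
proof (induction arbitrary: M' rule: phi_rel.induct)
  case empty
  then show ?case by cases auto
next
  case (flat \<alpha> a)
  from flat.prems show ?case
  proof (cases (no_simp))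
    case (flat \<alpha>' a')
    then show ?thesis using \<open>\<And>M'. phi_rel \<alpha> M' \<Longrightarrow> a = M'\<close> by simp
  next
    case (up \<alpha>' \<beta>' \<gamma>' a' b' c')
    have "dyck (U # \<beta>' @ D # \<gamma>')" using up dyck_append[OF dyck_U_D, of \<beta>' \<gamma>'] by simp
    then show ?thesis
      using up last_return_unique[of \<alpha> \<alpha>' "[]" "U # \<beta>' @ D # \<gamma>'"] flat.hyps
      by (simp flip: append_assoc append_Cons)
  qed simp
next
  case (up \<alpha> \<beta> \<gamma> a b c)
  have d: "dyck (U # \<beta> @ D # \<gamma>)" using up dyck_append[OF dyck_U_D, of \<beta> \<gamma>] by simp
  from up.prems show ?case
  proof (cases (no_simp))
    case (flat \<alpha>' a')
    have "(\<alpha> @ U # U # \<beta> @ D # \<gamma>) @ [D] = (\<alpha>' @ [U]) @ [D]" using flat by simp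
    then have "\<alpha> @ U # U # \<beta> @ D # \<gamma> = \<alpha>' @ [U]" by (simp only: append_same_eq)
    then show ?thesis
      using flat last_return_unique[of \<alpha> \<alpha>' "U # \<beta> @ D # \<gamma>" "[]"] up.hyps d by simp
  next
    case (up \<alpha>' \<beta>' \<gamma>' a' b' c')
    have d': "dyck (U # \<beta>' @ D # \<gamma>')" using up dyck_append[OF dyck_U_D, of \<beta>' \<gamma>'] by simp
    have "(\<alpha> @ U # U # \<beta> @ D # \<gamma>) @ [D] = (\<alpha>' @ U # U # \<beta>' @ D # \<gamma>') @ [D]" using up by simp
    then have "\<alpha> @ U # U # \<beta> @ D # \<gamma> = \<alpha>' @ U # U # \<beta>' @ D # \<gamma>'" by (simp only: append_same_eq)
    then have "\<alpha> = \<alpha>'" and "U # \<beta> @ D # \<gamma> = U # \<beta>' @ D # \<gamma>'"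
      using last_return_unique[OF \<open>dyck \<alpha>\<close> \<open>dyck \<alpha>'\<close> d d'] by simp_all
    moreover from this have "\<beta> = \<beta>'" "\<gamma> = \<gamma>'"
      using first_return_unique[OF \<open>dyck \<beta>\<close> \<open>dyck \<beta>'\<close>] by simp_all
    ultimately show ?thesis using up \<open>\<And>M'. phi_rel \<alpha> M' \<Longrightarrow> a = M'\<close>
        \<open>\<And>M'. phi_rel \<beta> M' \<Longrightarrow> b = M'\<close> \<open>\<And>M'. phi_rel \<gamma> M' \<Longrightarrow> c = M'\<close> by simp
  qed simp
qed

lemma phi_eqI: "phi_rel P M \<Longrightarrow> phi P = M"
  unfolding phi_def using phi_rel_unique by blast

lemma phi_rel_phi: "dyck P \<Longrightarrow> phi_rel P (phi P)"
  using phi_rel_total phi_eqI by blast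

lemma phi_empty: "phi [] = []"
  by (intro phi_eqI phi_rel.empty)

lemma phi_flat: "dyck \<alpha> \<Longrightarrow> phi (\<alpha> @ [U, D]) = phi \<alpha> @ [F]"
  by (intro phi_eqI phi_rel.flat phi_rel_phi)

lemma phi_up:
  "dyck \<alpha> \<Longrightarrow> dyck \<beta> \<Longrightarrow> dyck \<gamma> \<Longrightarrow>
    phi (\<alpha> @ [U, U] @ \<beta> @ [D] @ \<gamma> @ [D]) = phi \<alpha> @ phi \<gamma> @ [U] @ phi \<beta> @ [D]"
  by (intro phi_eqI phi_rel.up phi_rel_phi)

lemma phi_rel_motzkin: "phi_rel P M \<Longrightarrow> motzkin M \<and> length P = 2 * length M"
proof (induction rule: phi_rel.induct)
  case (flat \<alpha> a)
  then show ?case using motzkin_append motzkin_F by simp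
next
  case (up \<alpha> \<beta> \<gamma> a b c)
  then show ?case using motzkin_append motzkin_U_D by simp
qed simp

lemma phi_motzkin_paths: "P \<in> dyck_h_ge_paths n \<Longrightarrow> phi P \<in> motzkin_paths n"
  using phi_rel_motzkin[OF phi_rel_phi[OF dyck_h_ge_dyck]]
  by (fastforce simp: dyck_h_ge_paths_def motzkin_paths_def)

end

theory Submission
  imports Defs "HOL-Library.Sublist"
begin

text \<open>
  Both sides are sums over the decomposition \<open>P = \<alpha>UU\<beta>D\<gamma>D\<close>, where no occurrence of a counted word
  crosses the boundaries of \<open>\<alpha>\<close>, \<open>\<beta>\<close>, \<open>\<gamma>\<close> (or their images) except at the start of \<open>UU\<beta>\<close>
  and of \<open>U\<phi>(\<beta>)D\<close>. There \<open>UU\<beta>\<close> contributes one \<open>UUU\<close> if \<open>\<beta>\<close> is nonempty, and a second one if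
  \<open>\<beta>\<close> starts with \<open>UU\<close>. The height condition makes \<open>\<beta>\<close> start with \<open>UU\<close> unless its height is at
  most 1, i.e. unless \<open>\<phi>(\<beta>)\<close> consists of flat steps only; so \<open>U\<phi>(\<beta>)D\<close> starts with
  \<open>UF\<^sup>*U\<close> (weight 2), with \<open>UF\<^sup>+D\<close> (weight 1) or is \<open>UD\<close> (weight 0) in the respective cases.
\<close>

section \<open>Counting words by adding one step at the front\<close>

lemma occ_Nil: "X \<noteq> [] \<Longrightarrow> occ X [] = 0"
  by (simp add: occ_eq_0)

lemma occ_Cons:
  assumes "X \<noteq> []"
  shows "occ X (s # P) = occ X P + of_bool (prefix X (s # P))"
proof -
  define I where "I P = {i. i + length X \<le> length P \<and> take (length X) (drop i P) = X}" for P
  have fin: "finite (I P)"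
    by (rule finite_subset[of _ "{..length P}"]) (auto simp: I_def)
  have "i \<in> I (s # P) \<longleftrightarrow> i \<in> (if prefix X (s # P) then {0} else {}) \<union> Suc ` I P" for i
  proof (cases i)
    case 0
    have "0 \<in> I (s # P) \<longleftrightarrow> prefix X (s # P)"
      unfolding I_def using prefix_length_le[of X "s # P"]
      by (auto simp: prefix_def take_is_prefix) (metis append_take_drop_id)
    with 0 show ?thesis by auto
  qed (auto simp: I_def)
  then have "I (s # P) = (if prefix X (s # P) then {0} else {}) \<union> Suc ` I P" by blast
  then have "card (I (s # P)) = of_bool (prefix X (s # P)) + card (Suc ` I P)"
    using fin by (auto simp: card_insert_if)
  then show ?thesis
    unfolding occ_def I_def[symmetric] by (simp add: card_image)
qed

text \<open>As \<open>Z\<close> ends the run of flat steps, only one exponent \<open>k\<close> can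
  match; this collapses the sum over \<open>k\<close> below.\<close>

lemma prefix_replicate_snoc:
  assumes "Z \<noteq> F"
  shows "prefix (replicate k F @ [Z]) P \<longleftrightarrow>
    k = length (takeWhile ((=) F) P) \<and> prefix [Z] (dropWhile ((=) F) P)"
proof (induction P arbitrary: k)
  case (Cons s P)
  then show ?case using assms by (cases k) auto
qed auto

lemma occ_plus_Cons:
  assumes "Z \<noteq> F"
  shows "occ_plus [Y] F [Z] (s # P) = occ_plus [Y] F [Z] P +
    of_bool (s = Y \<and> takeWhile ((=) F) P \<noteq> [] \<and> prefix [Z] (dropWhile ((=) F) P))"
proof -
  \<comment> \<open>The bound \<open>?N\<close> truncates the sums for both \<open>P\<close> and
    \<open>s # P\<close>. The only new match is at \<open>k = ?t\<close>, which lies in the range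
    iff the flat run is nonempty.\<close>
  let ?N = "Suc (length P)" and ?t = "length (takeWhile ((=) F) P)"
  let ?b = "s = Y \<and> prefix [Z] (dropWhile ((=) F) P)"
  have t: "?t \<le> length P" by (rule length_takeWhile_le)
  have "occ_plus [Y] F [Z] (s # P) = (\<Sum>k = 1..?N. occ ([Y] @ replicate k F @ [Z]) (s # P))"
    by (rule occ_plus_finite) simp
  also have "\<dots> = (\<Sum>k = 1..?N. occ ([Y] @ replicate k F @ [Z]) P) +
      (\<Sum>k = 1..?N. if k = ?t then of_bool ?b else 0)"
    unfolding sum.distrib[symmetric]
    by (rule sum.cong) (use assms in \<open>auto simp: occ_Cons prefix_replicate_snoc\<close>)
  also have "(\<Sum>k = 1..?N. occ ([Y] @ replicate k F @ [Z]) P) = occ_plus [Y] F [Z] P"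
    by (rule occ_plus_finite[symmetric]) simp
  also have "(\<Sum>k = 1..?N. if k = ?t then of_bool ?b else 0 :: nat) =
      of_bool (s = Y \<and> takeWhile ((=) F) P \<noteq> [] \<and> prefix [Z] (dropWhile ((=) F) P))"
    using t by (subst sum.delta) (auto simp: Suc_le_eq)
  finally show ?thesis .
qed

lemma occ_plus_Nil: "occ_plus Y S Z [] = 0"
  by (simp add: occ_plus_finite[of _ 0])

section \<open>The weight of a Motzkin path\<close>

definition weight :: "step list \<Rightarrow> nat" where
  "weight M =
    occ_plus [U] F [D] M + 2 * (occ_plus [U] F [U] M + occ [U, U] M)"

text \<open>The gain in \<open>weight\<close> from putting a \<open>U\<close> in front of
  \<open>M\<close>. \<open>UU\<close> and \<open>UF\<^sup>+U\<close> share the coefficient 2, so the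
  run length matters only before a \<open>D\<close>.\<close>

definition run_weight :: "step list \<Rightarrow> nat" where
  "run_weight M = (case dropWhile ((=) F) M of
     U # _ \<Rightarrow> 2
   | D # _ \<Rightarrow> of_bool (takeWhile ((=) F) M \<noteq> [])
   | _ \<Rightarrow> 0)"

lemma weight_Nil: "weight [] = 0"
  by (simp add: weight_def occ_plus_Nil occ_Nil)

lemma weight_Cons: "weight (s # M) = (if s = U then run_weight M else 0) + weight M"
proof -
  have "prefix [U] M \<longleftrightarrow> takeWhile ((=) F) M = [] \<and> prefix [U] (dropWhile ((=) F) M)"
    by (cases M) auto
  then show ?thesis
    by (auto simp: weight_def run_weight_def occ_Cons occ_plus_Cons simp del: dropWhile_eq_Nil_conv
        split: list.split step.split)
qed

lemma run_weight_append:
  "\<not> set M \<subseteq> {F} \<Longrightarrow> run_weight (M @ N) = run_weight M"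
  unfolding run_weight_def
  by (auto simp: dropWhile_append takeWhile_append split: list.split step.split dest!: subsetD)

lemma level_flat: "set M \<subseteq> {F} \<Longrightarrow> level M = 0"
  by (induction M) auto

lemma motzkin_suffix: "motzkin (A @ B) \<Longrightarrow> level B \<le> 0"
  unfolding motzkin_iff by (metis add_le_same_cancel2 level_simps(3) add.commute)

text \<open>A counted word across the boundary would need a \<open>U\<close> in \<open>M\<close>
  followed only by flat steps, a suffix of level 1. The induction uses the bound on suffix levels
  because, unlike \<open>motzkin\<close>, it passes to tails.\<close>

lemma weight_append:
  assumes "motzkin M"
  shows "weight (M @ N) = weight M + weight N"
proof -
  have "weight (M @ N) = weight M + weight N"
    if "\<And>A B. M = A @ B \<Longrightarrow> level B \<le> 0" for M :: "step list"
    using that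
  proof (induction M)
    case (Cons s M)
    have IH: "weight (M @ N) = weight M + weight N"
      by (rule Cons.IH) (metis Cons.prems append_Cons)
    have "\<not> set M \<subseteq> {F}" if "s = U"
      using Cons.prems[of "[]" "s # M"] level_flat[of M] that by auto
    then show ?case using IH by (auto simp: weight_Cons run_weight_append)
  qed (simp add: weight_Nil)
  then show ?thesis using assms motzkin_suffix by metis
qed

lemma run_weight_motzkin_D:
  assumes "motzkin M"
  shows "run_weight (M @ [D]) = (if M = [] then 0 else if set M \<subseteq> {F} then 1 else 2)"
proof (cases "set M \<subseteq> {F}")
  case True
  then have "takeWhile ((=) F) (M @ [D]) = M" "dropWhile ((=) F) (M @ [D]) = [D]"
    by (auto simp: takeWhile_append dropWhile_append subset_iff)
  then show ?thesis using True by (simp add: run_weight_def)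
next
  case False
  then obtain s R where R: "dropWhile ((=) F) M = s # R"
    by (cases "dropWhile ((=) F) M") auto
  let ?T = "takeWhile ((=) F) M"
  have M: "M = (?T @ [s]) @ R"
    using R by (metis append.assoc append_Cons append_Nil takeWhile_dropWhile_id)
  \<comment> \<open>The first non-flat step starts at level 0, so it cannot be
    \<open>D\<close>.\<close>
  then have "0 \<le> level (?T @ [s])" using assms unfolding motzkin_iff by blast
  moreover have "level ?T = 0" by (rule level_flat) (auto dest: set_takeWhileD)
  moreover have "s \<noteq> F" using R by (metis hd_dropWhile list.sel(1) list.distinct(1))
  ultimately have "s = U" by (cases s) auto
  then have "run_weight M = 2" using R by (simp add: run_weight_def)
  then show ?thesis using False run_weight_append[OF False, of "[D]"] by auto
qed

section \<open>Occurrences of \<open>UUU\<close> and heights in Dyck paths\<close>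

lemma occ_UUU_append_D: "occ [U, U, U] (A @ D # B) = occ [U, U, U] A + occ [U, U, U] B"
proof (induction A)
  case Nil
  then show ?case by (simp add: occ_Cons occ_Nil)
next
  case (Cons s A)
  have "prefix [U, U, U] (s # A @ D # B) \<longleftrightarrow> prefix [U, U, U] (s # A)"
    by (cases A; cases "tl A") auto
  then show ?case using Cons by (simp add: occ_Cons)
qed

lemma occ_UUU_dyck_append:
  assumes "dyck A"
  shows "occ [U, U, U] (A @ B) = occ [U, U, U] A + occ [U, U, U] B"
proof (cases "A = []")
  case False
  then obtain Q where "A = Q @ [D]" using assms dyck_D_snoc by blast
  then show ?thesis by (simp add: occ_UUU_append_D occ_Nil)
qed (simp add: occ_Nil)

lemma height_le_iff: "height P \<le> k \<longleftrightarrow> (\<forall>A B. P = A @ B \<longrightarrow> level A \<le> k)"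
proof -
  have "height P \<le> k \<longleftrightarrow> (\<forall>i \<le> length P. level (take i P) \<le> k)"
    unfolding height_def by (subst Max_le_iff) auto
  also have "\<dots> \<longleftrightarrow> (\<forall>A B. P = A @ B \<longrightarrow> level A \<le> k)"
    by (metis append_take_drop_id append_eq_conv_conj length_append le_add1)
  finally show ?thesis .
qed

text \<open>Appending \<open>UD\<close> reaches only level 1, whereas the \<open>up\<close> rule
  puts a \<open>U\<close> in the image and reaches level 2 in the path.\<close>

lemma phi_rel_flat_iff: "phi_rel P M \<Longrightarrow> set M \<subseteq> {F} \<longleftrightarrow> height P \<le> 1"
proof (induction rule: phi_rel.induct)
  case empty
  then show ?case by (simp add: height_le_iff)
next
  case (flat \<alpha> a)
  have "height (\<alpha> @ [U, D]) \<le> 1 \<longleftrightarrow> height \<alpha> \<le> 1"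
    using dyck_level[OF flat.hyps(1)]
    by (auto simp: height_le_iff append_eq_append_conv2 Cons_eq_append_conv)
  then show ?case using flat.IH by simp
next
  case (up \<alpha> \<beta> \<gamma> a b c)
  have "level (\<alpha> @ [U, U]) = 2" using dyck_level[OF up.hyps(1)] by simp
  then have "\<not> height (\<alpha> @ [U, U] @ \<beta> @ [D] @ \<gamma> @ [D]) \<le> 1"
    unfolding height_le_iff by (metis append.assoc numeral_le_one_iff semiring_norm(69))
  then show ?case by simp
qed

text \<open>The height condition enters here: if the path starts with \<open>UD\<close>, the rest is
  no higher than \<open>UD\<close>, so the whole path has height at most 1.\<close>

lemma dyck_h_ge_starts_UU_iff:
  assumes "P \<in> dyck_h_ge"
  shows "prefix [U, U] P \<longleftrightarrow> \<not> height P \<le> 1"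
proof
  assume "prefix [U, U] P"
  then obtain R where "P = [U, U] @ R" by (auto simp: prefix_def)
  moreover have "\<not> level [U, U] \<le> 1" by simp
  ultimately show "\<not> height P \<le> 1" unfolding height_le_iff by blast
next
  assume h: "\<not> height P \<le> 1"
  from assms show "prefix [U, U] P"
  proof cases
    case empty
    then show ?thesis using h by (simp add: height_le_iff)
  next
    case (first_return \<alpha> \<beta>)
    show ?thesis
    proof (cases "\<alpha> = []")
      case True
      have "height [U, D] \<le> 1" by (auto simp: height_le_iff Cons_eq_append_conv)
      then have "height \<beta> \<le> 1" using first_return True by simp
      then have "height P \<le> 1" using first_return True
        by (auto simp: height_le_iff Cons_eq_append_conv)
      then show ?thesis using h by simp
    next
      case False
      then show ?thesis
        using first_return dyck_U_Cons[OF dyck_h_ge_dyck, of \<alpha>]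
        by (metis append_Cons append_Nil Cons_prefix_Cons Nil_prefix)
    qed
  qed
qed

section \<open>Comparison along the recursion of \<open>phi_rel\<close>\<close>

lemma occ_UUU_eq_weight:
  "phi_rel P M \<Longrightarrow> P \<in> dyck_h_ge \<Longrightarrow> occ [U, U, U] P = weight M"
proof (induction rule: phi_rel.induct)
  case empty
  then show ?case by (simp add: occ_Nil weight_Nil)
next
  case (flat \<alpha> a)
  have "\<alpha> \<in> dyck_h_ge" using flat.prems dyck_h_ge_last_return[of \<alpha> "[]"] flat.hyps by simp
  moreover have "motzkin a" using flat.hyps phi_rel_motzkin by blast
  ultimately show ?case
    using flat.IH flat.hyps(1)
    by (simp add: occ_UUU_dyck_append weight_append weight_Cons weight_Nil occ_Cons occ_Nil)
next
  case (up \<alpha> \<beta> \<gamma> a b c)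
  have mot: "motzkin a" "motzkin b" "motzkin c" using up.hyps phi_rel_motzkin by blast+
  have "dyck (U # \<beta> @ D # \<gamma>)" using up.hyps dyck_append[OF dyck_U_D, of \<beta> \<gamma>] by simp
  then have "\<alpha> \<in> dyck_h_ge \<and> U # \<beta> @ D # \<gamma> \<in> dyck_h_ge"
    using dyck_h_ge_last_return[of \<alpha> "U # \<beta> @ D # \<gamma>"] up.hyps up.prems by simp
  then have mem: "\<alpha> \<in> dyck_h_ge" "\<beta> \<in> dyck_h_ge" "\<gamma> \<in> dyck_h_ge"
    using dyck_h_ge_iff[of \<beta> \<gamma>] up.hyps by simp_all
  have "length \<beta> = 2 * length b" using up.hyps phi_rel_motzkin by blast
  then have Nil: "\<beta> = [] \<longleftrightarrow> b = []" by auto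
  have UU: "prefix [U, U] \<beta> \<longleftrightarrow> \<not> set b \<subseteq> {F}"
    using dyck_h_ge_starts_UU_iff[OF mem(2)] phi_rel_flat_iff up.hyps by blast
  have U: "prefix [U] \<beta> \<longleftrightarrow> \<beta> \<noteq> []"
    using dyck_U_Cons[OF up.hyps(2)]
    by (metis Cons_prefix_Cons Nil_prefix prefix_Nil list.distinct(1))
  have "occ [U, U, U] (\<alpha> @ [U, U] @ \<beta> @ [D] @ \<gamma> @ [D]) =
      occ [U, U, U] \<alpha> + occ [U, U, U] (U # U # \<beta>) + occ [U, U, U] \<gamma>"
    using occ_UUU_append_D[of "U # U # \<beta>" "\<gamma> @ [D]"] occ_UUU_append_D[of \<gamma> "[]"] up.hyps(1)
    by (simp add: occ_UUU_dyck_append occ_Nil)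
  \<comment> \<open>The two leading steps start 0, 1 or 2 occurrences as \<open>\<beta>\<close> is
    empty, nonempty of height at most 1, or higher; these are the three cases for
    \<open>b\<close>.\<close>
  also have "occ [U, U, U] (U # U # \<beta>) = run_weight (b @ [D]) + occ [U, U, U] \<beta>"
    using U UU Nil run_weight_motzkin_D[OF mot(2)] by (auto simp: occ_Cons)
  also have "occ [U, U, U] \<alpha> + (run_weight (b @ [D]) + occ [U, U, U] \<beta>) + occ [U, U, U] \<gamma> =
      weight (a @ c @ [U] @ b @ [D])"
    using up.IH mem mot by (simp add: weight_append weight_Cons weight_Nil)
  finally show ?case .
qed

theorem theorem4:
  fixes n :: nat and P :: "step list"
  assumes "P \<in> dyck_h_ge_paths n"
  shows "occ [U, U, U] P =
    occ_plus [U] F [D] (phi P) + 2 * (occ_plus [U] F [U] (phi P) + occ [U, U] (phi P))"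
proof -
  have "P \<in> dyck_h_ge" using assms by (simp add: dyck_h_ge_paths_def)
  then show ?thesis
    using occ_UUU_eq_weight phi_rel_phi dyck_h_ge_dyck unfolding weight_def by blast
qed

end
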